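(* Let $f\in H^{-2}(\Omega)$ and $\tilde f\in L^2(\Omega)$, let $u$ and $\tilde u$ be the solutions of the primal and dual clamped biharmonic problems with data $f$ and $\tilde f$, and let $Q(v)=(\tilde f,v)$. Let $u_h,\tilde u_h\in\mathbb P_k(\mathcal T_h)$ be arbitrary piecewise polynomial functions, let $s_h,\tilde s_h$ be potential reconstructions and $\boldsymbol\sigma_h^{\rm eq},\tilde{\boldsymbol\sigma}_h^{\rm eq}$ equilibrated moment tensors, with $f_h:=\mathrm{div}\,\mathrm{div}\,\boldsymbol\sigma_h^{\rm eq}$ and $\tilde f_h:=\mathrm{div}\,\mathrm{div}\,\tilde{\boldsymbol\sigma}_h^{\rm eq}$. Set $$\tilde{\boldsymbol\sigma}_h^{\rm m}:=\tfrac12\left(\tilde{\boldsymbol\sigma}_h^{\rm eq}+D^2\tilde s_h\right).$$ Then \begin{align*} &\left|Q(u)-Q(u_h)-\left(\boldsymbol\sigma_h^{\rm eq}-D^2s_h,\tilde{\boldsymbol\sigma}_h^{\rm m}\right)\right|\\ &\quad\le\|D^2s_h-\boldsymbol\sigma_h^{\rm eq}\|\left(\tfrac12\|D^2\tilde s_h-\tilde{\boldsymbol\sigma}_h^{\rm eq}\|+osc_{\rm dual}(\tilde f,\tilde u)\right)+\left|\langle f-f_h,\tilde s_h\rangle+Q(s_h-u_h)\right|+osc_{\rm prim}^2(f,\tilde u), \end{align*} where $osc_{\rm prim}(f,\tilde u)\ge0$ and $osc_{\rm dual}(\tilde f,\tilde u)\ge 0$ are defined by $osc_{\rm prim}^2(f,\tilde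 u):=|\langle f-f_h,\tilde u-\tilde s_h\rangle|$ and $osc_{\rm dual}^2(\tilde f,\tilde u):=|\langle\tilde f-\tilde f_h,\tilde u-\tilde s_h\rangle|$.
   Context: $\Omega\subset\mathbb R^2$ is a bounded polygonal Lipschitz domain and $\mathcal T_h$ is a shape-regular triangulation of $\Omega$ into closed triangles. $\mathbb P_k(\mathcal T_h)$ is the space of $L^2(\Omega)$ functions whose restriction to each $K\in\mathcal T_h$ is a polynomial of degree at most $k$. $(\cdot,\cdot)$ and $\|\cdot\|$ are the $L^2(\Omega)$ inner product and norm (for scalar or matrix fields, with $A:B=\sum_{i,j}A_{ij}B_{ij}$), and $\langle\cdot,\cdot\rangle$ is the duality pairing between $H^{-2}(\Omega)$ and $H^2_0(\Omega)$. $D^2v$ is the Hessian of $v$. Primal problem: $u\in H^2_0(\Omega)$ with $(D^2u,D^2v)=\langle f,v\rangle$ for all $v\in H^2_0(\Omega)$ (weak form of $\Delta^2u=f$ in $\Omega$, $u=\partial u/\partial\nu=0$ on $\partial\Omega$). Dual problem: $\tilde u\in H^2_0(\Omega)$ with $(D^2\tilde u,D^2v)=(\tilde f,v)$ for all $v\in H^2_0(\Omega)$. A potential reconstruction is any function in $H^2_0(\Omega)\cap C^1(\bar\Omega)$ ($s_h$ constructed from $u_h$, $\tilde s_h$ from $\tilde u_h$). For a symmetric matrix field $\boldsymbol\tau\in[L^2(\Omega)]^{2\times2}_{\rm sym}$, $\mathrm{div}\,\mathrm{div}\,\boldsymbol\tau\in H^{-2}(\Omega)$ is defined by $\langle\mathrm{div}\,\mathrm{div}\,\boldsymbol\tau,w\rangle=\int_\Omega\boldsymbol\tau:D^2w\,dx$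 for all $w\in H^2_0(\Omega)$. Given $f_h,\tilde f_h\in H^{-2}(\Omega)$, equilibrated moment tensors are fields $\boldsymbol\sigma_h^{\rm eq},\tilde{\boldsymbol\sigma}_h^{\rm eq}\in[L^2(\Omega)]^{2\times2}_{\rm sym}$ with $\mathrm{div}\,\mathrm{div}\,\boldsymbol\sigma_h^{\rm eq}=f_h$ and $\mathrm{div}\,\mathrm{div}\,\tilde{\boldsymbol\sigma}_h^{\rm eq}=\tilde f_h$; here $f_h$ and $\tilde f_h$ are defined by these equalities from given tensors. *)

theory Defs
  imports "HOL-Analysis.Analysis"
begin

section \<open>Square-integrable fields\<close>

text \<open>
  Elements of \<open>L\<^sup>2(\<Omega>)\<close> are represented by functions on the whole space of which only the values
  almost everywhere in \<open>\<Omega>\<close> matter. On \<^typ>\<open>real^2^2\<close> the library inner product is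
  \<open>A : B = \<Sum>\<^sub>i\<^sub>j A\<^sub>i\<^sub>j B\<^sub>i\<^sub>j\<close>, so the same definitions serve scalar, vector and matrix fields.
\<close>

definition L2 :: "('a::euclidean_space) set \<Rightarrow> ('a \<Rightarrow> 'b::euclidean_space) set" where
  "L2 \<Omega> = {f \<in> borel_measurable (lebesgue_on \<Omega>).
             integrable (lebesgue_on \<Omega>) (\<lambda>x. (norm (f x))\<^sup>2)}"

definition L2_inner ::
  "('a::euclidean_space) set \<Rightarrow> ('a \<Rightarrow> 'b::euclidean_space) \<Rightarrow> ('a \<Rightarrow> 'b) \<Rightarrow> real" where
  "L2_inner \<Omega> f g = (\<integral>x. f x \<bullet> g x \<partial>lebesgue_on \<Omega>)"

definition L2_norm :: "('a::euclidean_space) set \<Rightarrow> ('a \<Rightarrow> 'b::euclidean_space) \<Rightarrow> real" where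
  "L2_norm \<Omega> f = sqrt (L2_inner \<Omega> f f)"

definition L2_sym :: "('a::euclidean_space) set \<Rightarrow> ('a \<Rightarrow> real^'n^'n) set" where
  "L2_sym \<Omega> = {\<tau> \<in> L2 \<Omega>. AE x in lebesgue_on \<Omega>. transpose (\<tau> x) = \<tau> x}"


section \<open>Test functions and weak derivatives\<close>

definition partial_deriv :: "'n::finite \<Rightarrow> (real^'n \<Rightarrow> real) \<Rightarrow> real^'n \<Rightarrow> real" where
  "partial_deriv i \<phi> x = frechet_derivative \<phi> (at x) (axis i 1)"

text \<open>A list \<open>[i\<^sub>1, \<dots>, i\<^sub>m]\<close> of coordinate directions encodes \<open>\<partial>\<^sub>i\<^sub>1 \<dots> \<partial>\<^sub>i\<^sub>m\<close>.\<close>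

primrec partial_derivs :: "'n::finite list \<Rightarrow> (real^'n \<Rightarrow> real) \<Rightarrow> real^'n \<Rightarrow> real" where
  "partial_derivs [] \<phi> = \<phi>"
| "partial_derivs (i # \<alpha>) \<phi> = partial_deriv i (partial_derivs \<alpha> \<phi>)"

text \<open>Total differentiability of all iterated partial derivatives amounts to \<open>C\<^sup>\<infinity>\<close>.\<close>

definition smooth :: "(real^'n::finite \<Rightarrow> real) \<Rightarrow> bool" where
  "smooth \<phi> \<longleftrightarrow> (\<forall>\<alpha>. partial_derivs \<alpha> \<phi> differentiable_on UNIV)"

definition test_functions :: "(real^'n::finite) set \<Rightarrow> (real^'n \<Rightarrow> real) set" where
  "test_functions \<Omega> = {\<phi>. smooth \<phi> \<and> compact (closure {x. \<phi> x \<noteq> 0}) \<and> closure {x. \<phi> x \<noteq> 0} \<subseteq> \<Omega>}"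

definition is_weak_deriv ::
  "(real^'n::finite) set \<Rightarrow> 'n list \<Rightarrow> (real^'n \<Rightarrow> real) \<Rightarrow> (real^'n \<Rightarrow> real) \<Rightarrow> bool" where
  "is_weak_deriv \<Omega> \<alpha> v w \<longleftrightarrow>
     (\<forall>\<phi>\<in>test_functions \<Omega>.
        (\<integral>x. v x * partial_derivs \<alpha> \<phi> x \<partial>lebesgue_on \<Omega>)
        = (- 1) ^ length \<alpha> * (\<integral>x. w x * \<phi> x \<partial>lebesgue_on \<Omega>))"

text \<open>A representative of the weak derivative, which is unique only up to null sets.\<close>

definition weak_deriv :: "(real^'n::finite) set \<Rightarrow> 'n list \<Rightarrow> (real^'n \<Rightarrow> real) \<Rightarrow> real^'n \<Rightarrow> real" where
  "weak_deriv \<Omega> \<alpha> v = (SOME w. w \<in> L2 \<Omega> \<and> is_weak_deriv \<Omega> \<alpha> v w)"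

definition weak_gradient :: "(real^'n::finite) set \<Rightarrow> (real^'n \<Rightarrow> real) \<Rightarrow> real^'n \<Rightarrow> real^'n" where
  "weak_gradient \<Omega> v x = (\<chi> i. weak_deriv \<Omega> [i] v x)"

definition hessian :: "(real^'n::finite) set \<Rightarrow> (real^'n \<Rightarrow> real) \<Rightarrow> real^'n \<Rightarrow> real^'n^'n" where
  "hessian \<Omega> v x = (\<chi> i j. weak_deriv \<Omega> [i, j] v x)"


section \<open>Sobolev spaces\<close>

definition H2 :: "(real^'n::finite) set \<Rightarrow> (real^'n \<Rightarrow> real) set" where
  "H2 \<Omega> = {v \<in> L2 \<Omega>. \<forall>\<alpha>. length \<alpha> \<le> 2 \<longrightarrow> (\<exists>w\<in>L2 \<Omega>. is_weak_deriv \<Omega> \<alpha> v w)}"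

definition H2_norm :: "(real^'n::finite) set \<Rightarrow> (real^'n \<Rightarrow> real) \<Rightarrow> real" where
  "H2_norm \<Omega> v =
     sqrt ((L2_norm \<Omega> v)\<^sup>2 + (L2_norm \<Omega> (weak_gradient \<Omega> v))\<^sup>2 + (L2_norm \<Omega> (hessian \<Omega> v))\<^sup>2)"

definition H2_0 :: "(real^'n::finite) set \<Rightarrow> (real^'n \<Rightarrow> real) set" where
  "H2_0 \<Omega> = {v \<in> H2 \<Omega>. \<exists>\<phi>. (\<forall>n. \<phi> n \<in> test_functions \<Omega>) \<and>
                               (\<lambda>n. H2_norm \<Omega> (v - \<phi> n)) \<longlonglongrightarrow> 0}"

text \<open>
  \<open>H\<^sup>-\<^sup>2(\<Omega>)\<close> is the dual of \<open>H\<^sup>2\<^sub>0(\<Omega>)\<close>; the duality pairing \<open>\<langle>F, v\<rangle>\<close> is the application \<open>F v\<close>.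
  Linearity and boundedness force \<open>F\<close> to respect almost-everywhere equality;
  its values off \<open>H\<^sup>2\<^sub>0(\<Omega>)\<close> are irrelevant.
\<close>

definition H_minus2 :: "(real^'n::finite) set \<Rightarrow> ((real^'n \<Rightarrow> real) \<Rightarrow> real) set" where
  "H_minus2 \<Omega> = {F.
     (\<forall>v\<in>H2_0 \<Omega>. \<forall>w\<in>H2_0 \<Omega>. \<forall>a b. F (\<lambda>x. a * v x + b * w x) = a * F v + b * F w) \<and>
     (\<exists>C. \<forall>v\<in>H2_0 \<Omega>. \<bar>F v\<bar> \<le> C * H2_norm \<Omega> v)}"

definition div_div ::
  "(real^'n::finite) set \<Rightarrow> (real^'n \<Rightarrow> real^'n^'n) \<Rightarrow> (real^'n \<Rightarrow> real) \<Rightarrow> real" where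
  "div_div \<Omega> \<tau> w = L2_inner \<Omega> \<tau> (hessian \<Omega> w)"

text \<open>\<open>C\<^sup>1(closure \<Omega>)\<close>: the gradient in \<open>\<Omega>\<close> extends continuously to the closure.\<close>

definition C1_closure :: "(real^'n::finite) set \<Rightarrow> (real^'n \<Rightarrow> real) set" where
  "C1_closure \<Omega> = {v. continuous_on (closure \<Omega>) v \<and>
     (\<exists>G. continuous_on (closure \<Omega>) G \<and> (\<forall>x\<in>\<Omega>. (v has_derivative (\<lambda>h. G x \<bullet> h)) (at x)))}"


section \<open>Domain, triangulation and piecewise polynomials\<close>

text \<open>
  Near each boundary point \<open>\<Omega>\<close> is, in suitable Cartesian coordinates with axes \<open>e\<close>, \<open>n\<close>,
  the region above the graph of a Lipschitz function.
\<close>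

definition lipschitz_domain :: "(real^2) set \<Rightarrow> bool" where
  "lipschitz_domain \<Omega> \<longleftrightarrow> open \<Omega> \<and> connected \<Omega> \<and> \<Omega> \<noteq> {} \<and>
     (\<forall>x\<in>frontier \<Omega>. \<exists>e n r h L \<gamma>.
        norm e = 1 \<and> norm n = 1 \<and> e \<bullet> n = 0 \<and> 0 < r \<and> 0 < h \<and>
        L-lipschitz_on {-r<..<r} \<gamma> \<and>
        (\<forall>y. \<bar>(y - x) \<bullet> e\<bar> < r \<and> \<bar>(y - x) \<bullet> n\<bar> < h \<longrightarrow>
           (y \<in> \<Omega> \<longleftrightarrow> \<gamma> ((y - x) \<bullet> e) < (y - x) \<bullet> n) \<and>
           (y \<in> frontier \<Omega> \<longleftrightarrow> \<gamma> ((y - x) \<bullet> e) = (y - x) \<bullet> n)))"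

definition polygonal :: "(real^2) set \<Rightarrow> bool" where
  "polygonal \<Omega> \<longleftrightarrow> (\<exists>S. finite S \<and> frontier \<Omega> = (\<Union>(a, b)\<in>S. closed_segment a b))"

definition triangulation_of :: "(real^2) set \<Rightarrow> (real^2) set set \<Rightarrow> bool" where
  "triangulation_of \<Omega> \<T> \<longleftrightarrow> triangulation \<T> \<and> (\<forall>K\<in>\<T>. 2 simplex K) \<and> \<Union>\<T> = closure \<Omega>"

text \<open>Diameter of the largest ball contained in \<open>K\<close>.\<close>

definition insphere_diameter :: "(real^2) set \<Rightarrow> real" where
  "insphere_diameter K = Sup {2 * r | r. 0 \<le> r \<and> (\<exists>c. cball c r \<subseteq> K)}"

text \<open>
  Shape regularity of a family of triangulations means that one \<open>\<kappa>\<close> serves all its members.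
\<close>

definition shape_regular :: "real \<Rightarrow> (real^2) set set \<Rightarrow> bool" where
  "shape_regular \<kappa> \<T> \<longleftrightarrow> (\<forall>K\<in>\<T>. diameter K \<le> \<kappa> * insphere_diameter K)"

definition polynomials :: "nat \<Rightarrow> (real^2 \<Rightarrow> real) set" where
  "polynomials k = {p. \<exists>c. p = (\<lambda>x. \<Sum>i\<le>k. \<Sum>j\<le>k - i. c i j * (x $ 1) ^ i * (x $ 2) ^ j)}"

definition piecewise_polynomials ::
  "nat \<Rightarrow> (real^2) set \<Rightarrow> (real^2) set set \<Rightarrow> (real^2 \<Rightarrow> real) set" where
  "piecewise_polynomials k \<Omega> \<T> =
     {v \<in> L2 \<Omega>. \<forall>K\<in>\<T>. \<exists>p\<in>polynomials k. AE x in lebesgue_on K. v x = p x}"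


section \<open>Clamped biharmonic problem\<close>

definition biharmonic_solution ::
  "(real^2) set \<Rightarrow> ((real^2 \<Rightarrow> real) \<Rightarrow> real) \<Rightarrow> (real^2 \<Rightarrow> real) \<Rightarrow> bool" where
  "biharmonic_solution \<Omega> F u \<longleftrightarrow>
     u \<in> H2_0 \<Omega> \<and> (\<forall>v\<in>H2_0 \<Omega>. L2_inner \<Omega> (hessian \<Omega> u) (hessian \<Omega> v) = F v)"

definition potential_reconstructions :: "(real^2) set \<Rightarrow> (real^2 \<Rightarrow> real) set" where
  "potential_reconstructions \<Omega> = H2_0 \<Omega> \<inter> C1_closure \<Omega>"

text \<open>
  \<open>osc g g\<^sub>h v s\<close> is the nonnegative number with \<open>osc\<^sup>2 = \<bar>\<langle>g - g\<^sub>h, v - s\<rangle>\<bar>\<close>. For the dual oscillation,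
  \<open>g\<close> is the functional \<open>L2_inner \<Omega> f\<close> induced by an \<open>L\<^sup>2\<close> function \<open>f\<close>.
\<close>

definition osc ::
  "((real^2 \<Rightarrow> real) \<Rightarrow> real) \<Rightarrow> ((real^2 \<Rightarrow> real) \<Rightarrow> real) \<Rightarrow> (real^2 \<Rightarrow> real) \<Rightarrow> (real^2 \<Rightarrow> real) \<Rightarrow> real"
  where "osc g g\<^sub>h v s = sqrt \<bar>(g - g\<^sub>h) (v - s)\<bar>"

end

theory Submission
  imports Defs
begin

text \<open>
  Write \<open>(\<cdot>, \<cdot>)\<close> and \<open>\<parallel>\<cdot>\<parallel>\<close> for the \<open>L\<^sup>2\<close> inner product and norm, \<open>U'\<close>, \<open>S\<close>, \<open>S'\<close> for the Hessians of the
  dual solution \<open>u'\<close> and of the reconstructions \<open>s\<close>, \<open>s'\<close>, and \<open>\<sigma>\<close>, \<open>\<sigma>'\<close> for the equilibrated tensors.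
  The dual equation gives \<open>Q s = (S, U')\<close>; together with the primal one it gives \<open>Q u = f u'\<close>.
  With \<open>\<sigma>m = (\<sigma>' + S') / 2\<close> this yields the error identity
  \<open>Q u - Q u\<^sub>h - (\<sigma> - S, \<sigma>m) = (\<sigma> - S, U' - \<sigma>m) + (f - f\<^sub>h) s' + Q (s - u\<^sub>h) + (f - f\<^sub>h) (u' - s')\<close>.
  The last term has absolute value \<open>osc_prim\<^sup>2\<close>, and the first is bounded by Cauchy-Schwarz.

  It remains to show \<open>\<parallel>U' - \<sigma>m\<parallel> \<le> \<parallel>S' - \<sigma>'\<parallel> / 2 + osc_dual\<close>. Since \<open>\<sigma>m\<close> is the midpoint of \<open>\<sigma>'\<close> and \<open>S'\<close>,
  polarization (lemma \<open>L2_polarization\<close>) gives the Prager-Synge identity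
  \<open>\<parallel>U' - \<sigma>m\<parallel>\<^sup>2 = \<parallel>S' - \<sigma>'\<parallel>\<^sup>2 / 4 + (U' - \<sigma>', U' - S')\<close>, and by the dual equation and the definition of
  \<open>div div \<sigma>'\<close> the last inner product is \<open>\<langle>f' - f'\<^sub>h, u' - s'\<rangle>\<close>, of absolute value \<open>osc_dual\<^sup>2\<close>.

  Both oscillations evaluate \<open>div div\<close> of a given tensor at the difference \<open>u' - s'\<close>, so its linearity is
  needed (lemma \<open>div_div_diff\<close>). Weak derivatives are chosen representatives, and linearity of the Hessian
  almost everywhere amounts to uniqueness of weak derivatives, that is, to the fundamental lemma of
  the calculus of variations (\<open>fundamental_lemma_calculus_of_variations\<close>). For the latter, products of
  rescaled copies of \<open>exp (- 1 / t)\<close> are test functions that converge boundedly to the indicator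
  function of an open box, and boxes generate the Borel sets.
\<close>

section \<open>Smooth functions approximating indicators of boxes\<close>

text \<open>
  \<open>flat k\<close> is \<open>t\<^sup>-\<^sup>k exp (- 1 / t)\<close>, extended by zero to \<open>t \<le> 0\<close>. The span of these functions is
  closed under differentiation, so the standard function \<open>flat 0\<close> is \<open>C\<^sup>\<infinity>\<close>.
\<close>

definition flat :: "nat \<Rightarrow> real \<Rightarrow> real" where
  "flat k t = (if t \<le> 0 then 0 else (1 / t) ^ k * exp (- (1 / t)))"

lemma flat_has_real_derivative:
  "(flat k has_real_derivative flat (k + 2) t - real k * flat (k + 1) t) (at t)"
proof -
  consider "t < 0" | "t > 0" | "t = 0" by linarith
  then show ?thesis
  proof cases
    case 1
    have "(flat k has_real_derivative 0) (at t)"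
      by (rule has_field_derivative_transform_within_open[of "\<lambda>_. 0" _ _ "{..<0}"])
        (use 1 in \<open>auto simp: flat_def\<close>)
    with 1 show ?thesis by (simp add: flat_def)
  next
    case 2
    have "((\<lambda>t. (1 / t) ^ k * exp (- (1 / t))) has_real_derivative
            flat (k + 2) t - real k * flat (k + 1) t) (at t)"
    proof -
      have "((\<lambda>t. (1 / t) ^ k * exp (- (1 / t))) has_real_derivative
              (1 / t) ^ k * (exp (- (1 / t)) * (1 / t)\<^sup>2) +
              real k * (1 / t) ^ (k - 1) * (- (1 / t)\<^sup>2) * exp (- (1 / t))) (at t)"
        using 2 by (auto intro!: derivative_eq_intros simp: power2_eq_square)
      also have "real k * (1 / t) ^ (k - 1) * (- (1 / t)\<^sup>2) = - (real k * (1 / t) ^ (k + 1))"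
        by (cases k) (simp_all add: power2_eq_square)
      finally show ?thesis
        using 2 by (simp add: flat_def power2_eq_square mult_ac)
    qed
    then show ?thesis
      by (rule has_field_derivative_transform_within_open[where S = "{0<..}"])
        (use 2 in \<open>auto simp: flat_def\<close>)
  next
    case 3
    \<comment> \<open>The difference quotient of \<open>flat k\<close> at \<open>0\<close> is \<open>flat (Suc k)\<close>.\<close>
    have "((\<lambda>h. flat (Suc k) h) \<longlongrightarrow> 0) (at_right 0)"
    proof (rule Lim_transform_eventually)
      show "((\<lambda>h::real. inverse h ^ Suc k / exp (inverse h)) \<longlongrightarrow> 0) (at_right 0)"
        by (rule filterlim_compose[OF tendsto_power_div_exp_0 filterlim_inverse_at_top_right])
      show "\<forall>\<^sub>F h in at_right 0. inverse h ^ Suc k / exp (inverse h) = flat (Suc k) h"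
        unfolding eventually_at_filter
        by (intro always_eventually)
          (auto simp: flat_def exp_minus divide_simps)
    qed
    moreover have "((\<lambda>h. flat (Suc k) h) \<longlongrightarrow> 0) (at_left 0)"
      by (rule Lim_transform_eventually[OF tendsto_const])
        (auto simp: eventually_at_filter flat_def)
    ultimately have "((\<lambda>h. flat (Suc k) h) \<longlongrightarrow> 0) (at 0)"
      by (simp add: filterlim_split_at)
    then have "((\<lambda>h. (flat k (0 + h) - flat k 0) / h) \<longlongrightarrow> 0) (at 0)"
      by (rule Lim_transform_eventually) (auto simp: eventually_at_filter flat_def)
    with 3 show ?thesis by (simp add: DERIV_def flat_def)
  qed
qed

text \<open>
  An algebra of functions on \<open>\<real>\<^sup>n\<close>, generated by \<open>flat k\<close> composed with affine functions of a single
  coordinate. It is closed under partial differentiation, hence consists of smooth functions.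
\<close>

inductive_set flat_algebra :: "(real^'n::finite \<Rightarrow> real) set" where
  const: "(\<lambda>x. c) \<in> flat_algebra"
| flat: "(\<lambda>x. flat k (c * x $ i + d)) \<in> flat_algebra"
| add: "\<phi> \<in> flat_algebra \<Longrightarrow> \<psi> \<in> flat_algebra \<Longrightarrow> (\<lambda>x. \<phi> x + \<psi> x) \<in> flat_algebra"
| mult: "\<phi> \<in> flat_algebra \<Longrightarrow> \<psi> \<in> flat_algebra \<Longrightarrow> (\<lambda>x. \<phi> x * \<psi> x) \<in> flat_algebra"

lemma flat_algebra_has_derivative:
  fixes \<phi> :: "real^'n::finite \<Rightarrow> real"
  assumes "\<phi> \<in> flat_algebra"
  shows "\<exists>D. (\<forall>x. (\<phi> has_derivative D x) (at x)) \<and> (\<forall>i. (\<lambda>x. D x (axis i 1)) \<in> flat_algebra)"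
  using assms
proof induction
  case (const c)
  show ?case by (intro exI[of _ "\<lambda>x h. 0"]) (auto intro: flat_algebra.const)
next
  case (flat k c i d)
  let ?e = "\<lambda>x::real^'n. flat (k + 2) (c * x $ i + d) + - real k * flat (k + 1) (c * x $ i + d)"
  have "((\<lambda>x. flat k (c * x $ i + d)) has_derivative (\<lambda>h. c * h $ i * ?e x)) (at x)" for x :: "real^'n"
  proof -
    have "((\<lambda>x::real^'n. c * x $ i + d) has_derivative (\<lambda>h. c * h $ i)) (at x)"
      by (auto intro!: derivative_eq_intros bounded_linear_imp_has_derivative bounded_linear_vec_nth)
    from DERIV_compose_FDERIV[OF flat_has_real_derivative this]
    show ?thesis by (simp add: algebra_simps)
  qed
  moreover have "(\<lambda>x::real^'n. c * axis j 1 $ i * ?e x) \<in> flat_algebra" for j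
    by (intro flat_algebra.intros)
  ultimately show ?case by (intro exI[of _ "\<lambda>x h. c * h $ i * ?e x"] conjI allI)
next
  case (add \<phi> \<psi>)
  then obtain D E where "\<forall>x. (\<phi> has_derivative D x) (at x)" "\<forall>i. (\<lambda>x. D x (axis i 1)) \<in> flat_algebra"
    "\<forall>x. (\<psi> has_derivative E x) (at x)" "\<forall>i. (\<lambda>x. E x (axis i 1)) \<in> flat_algebra"
    by blast
  then show ?case
    by (intro exI[of _ "\<lambda>x h. D x h + E x h"])
      (auto intro!: has_derivative_add flat_algebra.intros)
next
  case (mult \<phi> \<psi>)
  then obtain D E where "\<forall>x. (\<phi> has_derivative D x) (at x)" "\<forall>i. (\<lambda>x. D x (axis i 1)) \<in> flat_algebra"
    "\<forall>x. (\<psi> has_derivative E x) (at x)" "\<forall>i. (\<lambda>x. E x (axis i 1)) \<in> flat_algebra"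
    by blast
  with mult show ?case
    by (intro exI[of _ "\<lambda>x h. \<phi> x * E x h + D x h * \<psi> x"])
      (auto intro!: has_derivative_mult flat_algebra.intros)
qed

lemma partial_deriv_flat_algebra:
  assumes "\<phi> \<in> flat_algebra"
  shows "partial_deriv i \<phi> \<in> flat_algebra"
proof -
  obtain D where D: "\<And>x. (\<phi> has_derivative D x) (at x)" "(\<lambda>x. D x (axis i 1)) \<in> flat_algebra"
    using flat_algebra_has_derivative[OF assms] by blast
  have "partial_deriv i \<phi> = (\<lambda>x. D x (axis i 1))"
    by (rule ext) (simp add: partial_deriv_def frechet_derivative_at[OF D(1), symmetric])
  with D(2) show ?thesis by simp
qed

lemma smooth_flat_algebra:
  assumes "\<phi> \<in> flat_algebra"
  shows "smooth \<phi>"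
proof -
  have "partial_derivs \<alpha> \<phi> \<in> flat_algebra" for \<alpha>
    by (induction \<alpha>) (simp_all add: assms partial_deriv_flat_algebra)
  then show ?thesis
    unfolding smooth_def differentiable_on_def differentiable_def
    by (metis flat_algebra_has_derivative)
qed

lemma prod_flat_algebra:
  assumes "finite I" "\<And>i. i \<in> I \<Longrightarrow> \<phi> i \<in> flat_algebra"
  shows "(\<lambda>x. \<Prod>i\<in>I. \<phi> i x) \<in> flat_algebra"
  using assms by (induction I) (auto intro: flat_algebra.intros)

text \<open>
  Each factor is smooth and vanishes unless \<open>x $ i\<close> lies at distance more than \<open>1 / Suc n\<close> inside the
  interval from \<open>a $ i\<close> to \<open>b $ i\<close>; the shift by one makes the support a compact subset of the open box.
\<close>

definition box_bump :: "real^'n::finite \<Rightarrow> real^'n \<Rightarrow> nat \<Rightarrow> real^'n \<Rightarrow> real" where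
  "box_bump a b n x = (\<Prod>i\<in>UNIV. flat 0 (real (Suc n) * (x $ i - a $ i) - 1) *
                                  flat 0 (real (Suc n) * (b $ i - x $ i) - 1))"

lemma flat_0_bounds: "0 \<le> flat 0 t" "flat 0 t \<le> 1"
  by (auto simp: flat_def)

lemma box_bump_bounds: "0 \<le> box_bump a b n x" "box_bump a b n x \<le> 1"
  unfolding box_bump_def
  by (auto intro!: prod_nonneg prod_le_1 mult_le_one flat_0_bounds mult_nonneg_nonneg)

lemma flat_0_tendsto_1:
  assumes "0 < t"
  shows "(\<lambda>n. flat 0 (real (Suc n) * t - 1)) \<longlonglongrightarrow> 1"
proof -
  have "filterlim (\<lambda>n. - 1 + t * real n) at_top sequentially"
    by (intro filterlim_tendsto_add_at_top[OF tendsto_const]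
        filterlim_tendsto_pos_mult_at_top[OF tendsto_const assms] filterlim_real_sequentially)
  then have lim: "filterlim (\<lambda>n. real n * t - 1) at_top sequentially"
    by (simp add: mult.commute)
  have "(\<lambda>n. exp (- inverse (real n * t - 1))) \<longlonglongrightarrow> exp (- 0)"
    by (intro tendsto_exp tendsto_minus tendsto_inverse_0_at_top lim)
  moreover have "\<forall>\<^sub>F n in sequentially. 0 < real n * t - 1"
    using lim unfolding filterlim_at_top_dense by blast
  then have "\<forall>\<^sub>F n in sequentially. exp (- inverse (real n * t - 1)) = flat 0 (real n * t - 1)"
    by eventually_elim (simp add: flat_def inverse_eq_divide)
  ultimately have "(\<lambda>n. flat 0 (real n * t - 1)) \<longlonglongrightarrow> exp (- 0)"
    by (rule Lim_transform_eventually)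
  then show ?thesis using LIMSEQ_Suc by fastforce
qed

lemma box_bump_tendsto_indicator:
  fixes a b x :: "real^'n::finite"
  shows "(\<lambda>n. box_bump a b n x) \<longlonglongrightarrow> indicator (box a b) x"
proof (cases "x \<in> box a b")
  case True
  then have "0 < x $ i - a $ i" "0 < b $ i - x $ i" for i
    by (auto simp: mem_box_cart)
  then have "(\<lambda>n. box_bump a b n x) \<longlonglongrightarrow> (\<Prod>i\<in>(UNIV :: 'n set). 1 * 1)"
    unfolding box_bump_def by (intro tendsto_prod tendsto_mult flat_0_tendsto_1)
  with True show ?thesis by simp
next
  case False
  then obtain i where i: "x $ i - a $ i \<le> 0 \<or> b $ i - x $ i \<le> 0"
    by (force simp: mem_box_cart not_less)
  have "box_bump a b n x = 0" for n
  proof -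
    have "real (Suc n) * (x $ i - a $ i) \<le> 0 \<or> real (Suc n) * (b $ i - x $ i) \<le> 0"
      using i by (auto intro: mult_nonneg_nonpos simp del: of_nat_Suc)
    then have "flat 0 (real (Suc n) * (x $ i - a $ i) - 1) * flat 0 (real (Suc n) * (b $ i - x $ i) - 1) = 0"
      by (auto simp: flat_def)
    then show ?thesis unfolding box_bump_def by (intro prod_zero) auto
  qed
  with False show ?thesis by simp
qed

lemma box_bump_in_test_functions:
  assumes "box a b \<subseteq> \<Omega>"
  shows "box_bump a b n \<in> test_functions \<Omega>"
proof -
  define N where "N = real (Suc n)"
  have N: "N > 0" by (simp add: N_def)
  let ?K = "cbox (a + (\<chi> i. 1 / N)) (b - (\<chi> i. 1 / N))"
  have "box_bump a b n = (\<lambda>x. \<Prod>i\<in>UNIV. flat 0 (N * x $ i + (- N * a $ i - 1)) *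
          flat 0 (- N * x $ i + (N * b $ i - 1)))"
    by (rule ext) (simp add: box_bump_def N_def algebra_simps)
  also have "\<dots> \<in> flat_algebra"
    by (intro prod_flat_algebra flat_algebra.intros) auto
  finally have "smooth (box_bump a b n)" by (rule smooth_flat_algebra)
  moreover have "{x. box_bump a b n x \<noteq> 0} \<subseteq> ?K"
  proof (clarsimp simp: mem_box_cart)
    fix x i assume "box_bump a b n x \<noteq> 0"
    then have "flat 0 (N * (x $ i - a $ i) - 1) \<noteq> 0" "flat 0 (N * (b $ i - x $ i) - 1) \<noteq> 0"
      unfolding box_bump_def N_def by (simp_all add: prod_zero_iff)
    then have "N * (x $ i - a $ i) > 1" "N * (b $ i - x $ i) > 1"
      by (auto simp: flat_def split: if_splits)
    with N show "a $ i + 1 / N \<le> x $ i \<and> x $ i \<le> b $ i - 1 / N"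
      by (simp add: field_simps)
  qed
  then have supp: "closure {x. box_bump a b n x \<noteq> 0} \<subseteq> ?K"
    by (rule closure_minimal) (rule closed_cbox)
  moreover have "compact (closure {x. box_bump a b n x \<noteq> 0})"
    using supp bounded_subset[OF bounded_cbox] by (auto simp: compact_eq_bounded_closed)
  moreover have "?K \<subseteq> box a b"
  proof
    fix x assume x: "x \<in> ?K"
    have "a $ i < x $ i \<and> x $ i < b $ i" for i
    proof -
      have "a $ i + 1 / N \<le> x $ i" "x $ i \<le> b $ i - 1 / N"
        using x by (auto simp: mem_box_cart)
      moreover have "0 < 1 / N" using N by simp
      ultimately show ?thesis by linarith
    qed
    then show "x \<in> box a b" by (simp add: mem_box_cart)
  qed
  ultimately show ?thesis using assms by (auto simp: test_functions_def)
qed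

section \<open>The fundamental lemma of the calculus of variations\<close>

text \<open>
  Open boxes form an intersection-stable generator of the Borel sets. The vanishing total integral
  serves the passage to complements.
\<close>

lemma AE_zero_if_integral_boxes_zero:
  fixes h :: "'a::euclidean_space \<Rightarrow> real"
  assumes h: "integrable lebesgue h"
    and total: "(\<integral>x. h x \<partial>lebesgue) = 0"
    and boxes: "\<And>a b. (LINT x:box a b|lebesgue. h x) = 0"
  shows "AE x in lebesgue. h x = 0"
proof -
  have int: "set_integrable lebesgue A h" if "A \<in> sets lebesgue" for A
    unfolding set_integrable_def by (rule integrable_mult_indicator[OF that h])
  have borel: "(LINT x:A|lebesgue. h x) = 0" if "A \<in> sets borel" for A
  proof -
    have lebesgueI: "B \<in> sets lebesgue" if "B \<in> sigma_sets UNIV (range (\<lambda>(a, b). box a b))" for B :: "'a set"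
    proof -
      have "B \<in> sets borel" using that by (simp add: borel_eq_box)
      then show ?thesis by simp
    qed
    have "Int_stable (range (\<lambda>(a, b). box a b :: 'a set))"
      by (auto simp: Int_stable_def box_Int_box)
    moreover have "range (\<lambda>(a, b). box a b :: 'a set) \<subseteq> Pow UNIV"
      by simp
    moreover have "A \<in> sigma_sets UNIV (range (\<lambda>(a, b). box a b))"
      using that by (simp add: borel_eq_box)
    ultimately show ?thesis
    proof (induction rule: sigma_sets_induct_disjoint)
      case (basic B)
      then show ?case using boxes by auto
    next
      case (compl B)
      have "(LINT x:UNIV - B \<union> B|lebesgue. h x) = (LINT x:UNIV - B|lebesgue. h x) + (LINT x:B|lebesgue. h x)"
        using lebesgueI[OF compl.hyps(1)] by (intro set_integral_Un int) auto
      with total compl.IH show ?case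
        by (simp add: set_lebesgue_integral_def)
    next
      case (union B)
      have B: "B i \<in> sets lebesgue" for i using union.hyps(2) by (intro lebesgueI) auto
      have "(LINT x:(\<Union>i. B i)|lebesgue. h x) = (\<Sum>i. (LINT x:B i|lebesgue. h x))"
        using union.hyps(1) B
        by (intro lebesgue_integral_countable_add int) (auto simp: disjoint_family_on_def)
      with union.IH show ?case by simp
    qed (simp add: set_lebesgue_integral_def)
  qed
  have "(LINT x:A|lebesgue. h x) = 0" if "A \<in> sets lebesgue" for A
  proof -
    from that obtain S N N' where A: "A = S \<union> N" "N \<subseteq> N'" "N' \<in> null_sets lborel" "S \<in> sets lborel"
      by (rule sets_completionE)
    have "AE x in lebesgue. x \<notin> N'"
      using A(3) by (intro AE_completion AE_not_in)
    then have "AE x in lebesgue. x \<in> S \<longleftrightarrow> x \<in> A"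
      by eventually_elim (use A in auto)
    moreover have "set_borel_measurable lebesgue B h" if "B \<in> sets lebesgue" for B
      using borel_measurable_integrable[OF int[OF that, unfolded set_integrable_def]]
      by (simp add: set_borel_measurable_def)
    ultimately have "(LINT x:A|lebesgue. h x) = (LINT x:S|lebesgue. h x)"
      using A(4) that by (intro set_integral_cong_set) auto
    with borel[of S] A(4) show ?thesis by simp
  qed
  then show ?thesis
    by (intro density_unique_real[OF h]) (auto simp: set_lebesgue_integral_def)
qed

lemma fundamental_lemma_calculus_of_variations:
  fixes w :: "real^'n::finite \<Rightarrow> real"
  assumes "open \<Omega>" and w: "integrable (lebesgue_on \<Omega>) w"
    and zero: "\<And>\<phi>. \<phi> \<in> test_functions \<Omega> \<Longrightarrow> (\<integral>x. w x * \<phi> x \<partial>lebesgue_on \<Omega>) = 0"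
  shows "AE x in lebesgue_on \<Omega>. w x = 0"
proof -
  have \<Omega>: "\<Omega> \<in> sets lebesgue" using \<open>open \<Omega>\<close> by simp
  have w': "integrable lebesgue (\<lambda>x. indicator \<Omega> x * w x)"
    using w \<Omega> by (simp add: integrable_restrict_space)
  have box: "(LINT x:box a b|lebesgue. w x) = 0" if ab: "box a b \<subseteq> \<Omega>" for a b
  proof -
    have meas: "box_bump a b n \<in> borel_measurable lebesgue" for n
    proof -
      have "box_bump a b n differentiable_on UNIV"
        using box_bump_in_test_functions[OF ab, of n]
        unfolding test_functions_def smooth_def by (auto dest: spec[of _ "[]"])
      then show ?thesis
        by (intro measurable_completion borel_measurable_continuous_onI)
          (simp_all add: differentiable_imp_continuous_on borel_measurable_continuous_onI)
    qed
    have "(\<lambda>n. \<integral>x. indicator \<Omega> x * w x * box_bump a b n x \<partial>lebesgue)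
            \<longlonglongrightarrow> (\<integral>x. indicator \<Omega> x * w x * indicator (box a b) x \<partial>lebesgue)"
    proof (rule integral_dominated_convergence[where w = "\<lambda>x. \<bar>indicator \<Omega> x * w x\<bar>"])
      show "AE x in lebesgue. norm (indicator \<Omega> x * w x * box_bump a b n x) \<le> \<bar>indicator \<Omega> x * w x\<bar>" for n
        using box_bump_bounds[of a b n]
        by (intro always_eventually) (auto simp: abs_mult intro!: mult_left_le)
      show "AE x in lebesgue. (\<lambda>n. indicator \<Omega> x * w x * box_bump a b n x)
              \<longlonglongrightarrow> indicator \<Omega> x * w x * indicator (box a b) x"
        by (intro always_eventually allI tendsto_mult tendsto_const box_bump_tendsto_indicator)
      show "(\<lambda>x. indicator \<Omega> x * w x * indicator (box a b) x) \<in> borel_measurable lebesgue"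
        by (intro borel_measurable_times borel_measurable_integrable[OF w'] borel_measurable_indicator)
          simp
      show "(\<lambda>x. indicator \<Omega> x * w x * box_bump a b n x) \<in> borel_measurable lebesgue" for n
        by (intro borel_measurable_times borel_measurable_integrable[OF w'] meas)
    qed (use w' in simp)
    moreover have "(\<integral>x. indicator \<Omega> x * w x * box_bump a b n x \<partial>lebesgue) = 0" for n
      using zero[OF box_bump_in_test_functions[OF ab, of n]] \<Omega>
      by (simp add: integral_restrict_space mult.assoc)
    ultimately have "(\<integral>x. indicator \<Omega> x * w x * indicator (box a b) x \<partial>lebesgue) = 0"
      by (simp add: LIMSEQ_const_iff)
    also have "(\<lambda>x. indicator \<Omega> x * w x * indicator (box a b) x) = (\<lambda>x. indicator (box a b) x *\<^sub>R w x)"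
      using ab by (auto simp: fun_eq_iff indicator_def)
    finally show ?thesis by (simp add: set_lebesgue_integral_def)
  qed
  have AE_box: "AE x in lebesgue. x \<in> box a b \<longrightarrow> w x = 0" if ab: "box a b \<subseteq> \<Omega>" for a b
  proof -
    let ?h = "\<lambda>x. indicator (box a b) x *\<^sub>R w x"
    have "AE x in lebesgue. ?h x = 0"
    proof (rule AE_zero_if_integral_boxes_zero)
      have "integrable lebesgue (\<lambda>x. indicator (box a b) x *\<^sub>R (indicator \<Omega> x * w x))"
        by (rule integrable_mult_indicator[OF _ w']) simp
      also have "(\<lambda>x. indicator (box a b) x *\<^sub>R (indicator \<Omega> x * w x)) = ?h"
        using ab by (auto simp: fun_eq_iff indicator_def)
      finally show "integrable lebesgue ?h" .
      show "(\<integral>x. ?h x \<partial>lebesgue) = 0"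
        using box[OF ab] by (simp add: set_lebesgue_integral_def)
      show "(LINT x:box c d|lebesgue. ?h x) = 0" for c d
      proof -
        obtain p q where pq: "box c d \<inter> box a b = box p q" using box_Int_box by blast
        then have "box p q \<subseteq> \<Omega>" using ab by blast
        from box[OF this] show ?thesis
          by (simp add: set_lebesgue_integral_def pq[symmetric] indicator_inter_arith mult.assoc)
      qed
    qed
    then show ?thesis by eventually_elim auto
  qed
  \<comment> \<open>The rational boxes inside \<open>\<Omega>\<close> form a countable cover of \<open>\<Omega>\<close>.\<close>
  define I where "I = {f \<in> (Basis :: (real^'n) set) \<rightarrow>\<^sub>E \<rat> \<times> \<rat>.
      box (\<Sum>i\<in>Basis. fst (f i) *\<^sub>R i) (\<Sum>i\<in>Basis. snd (f i) *\<^sub>R i) \<subseteq> \<Omega>}"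
  have "countable ((Basis :: (real^'n) set) \<rightarrow>\<^sub>E (\<rat> \<times> \<rat> :: (real \<times> real) set))"
    by (intro countable_PiE countable_SIGMA countable_rat) auto
  then have "countable I" unfolding I_def by (rule countable_subset[rotated]) blast
  then have AE: "AE x in lebesgue. \<forall>f\<in>I. x \<in> box (\<Sum>i\<in>Basis. fst (f i) *\<^sub>R i) (\<Sum>i\<in>Basis. snd (f i) *\<^sub>R i) \<longrightarrow> w x = 0"
    by (intro AE_ball_countable[THEN iffD2] ballI AE_box) (auto simp: I_def)
  have Un: "\<Omega> = (\<Union>f\<in>I. box (\<Sum>i\<in>Basis. fst (f i) *\<^sub>R i) (\<Sum>i\<in>Basis. snd (f i) *\<^sub>R i))"
    unfolding I_def by (rule open_UNION_box[OF \<open>open \<Omega>\<close>])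
  have "AE x in lebesgue. x \<in> \<Omega> \<longrightarrow> w x = 0"
    using AE by (rule eventually_mono) (use Un in blast)
  then show ?thesis using \<Omega> by (simp add: AE_restrict_space_iff)
qed
section \<open>Square-integrable fields\<close>

lemma L2_inner_integrable:
  assumes "f \<in> L2 \<Omega>" "g \<in> L2 \<Omega>"
  shows "integrable (lebesgue_on \<Omega>) (\<lambda>x. f x \<bullet> g x)"
proof (rule Bochner_Integration.integrable_bound[where f = "\<lambda>x. (norm (f x))\<^sup>2 + (norm (g x))\<^sup>2"])
  show "AE x in lebesgue_on \<Omega>. norm (f x \<bullet> g x) \<le> norm ((norm (f x))\<^sup>2 + (norm (g x))\<^sup>2)"
  proof (intro always_eventually allI)
    fix x
    have "\<bar>f x \<bullet> g x\<bar> \<le> norm (f x) * norm (g x)" by (rule Cauchy_Schwarz_ineq2)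
    also have "\<dots> \<le> (norm (f x))\<^sup>2 + (norm (g x))\<^sup>2"
      using sum_squares_bound[of "norm (f x)" "norm (g x)"]
        mult_nonneg_nonneg[OF norm_ge_zero norm_ge_zero, of "f x" "g x"] by linarith
    finally show "norm (f x \<bullet> g x) \<le> norm ((norm (f x))\<^sup>2 + (norm (g x))\<^sup>2)" by simp
  qed
qed (use assms in \<open>auto simp: L2_def\<close>)

lemma L2_scaleR: "f \<in> L2 \<Omega> \<Longrightarrow> (\<lambda>x. c *\<^sub>R f x) \<in> L2 \<Omega>"
  by (auto simp: L2_def power_mult_distrib)

lemma L2_add:
  assumes "f \<in> L2 \<Omega>" "g \<in> L2 \<Omega>"
  shows "(\<lambda>x. f x + g x) \<in> L2 \<Omega>"
proof -
  have "integrable (lebesgue_on \<Omega>) (\<lambda>x. (norm (f x))\<^sup>2 + (norm (g x))\<^sup>2 + 2 * (f x \<bullet> g x))"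
    using assms L2_inner_integrable[OF assms] by (auto simp: L2_def)
  also have "(\<lambda>x. (norm (f x))\<^sup>2 + (norm (g x))\<^sup>2 + 2 * (f x \<bullet> g x)) = (\<lambda>x. (norm (f x + g x))\<^sup>2)"
    by (simp add: fun_eq_iff power2_norm_eq_inner inner_add inner_commute)
  finally show ?thesis using assms by (auto simp: L2_def)
qed

lemma L2_diff:
  assumes "f \<in> L2 \<Omega>" "g \<in> L2 \<Omega>"
  shows "f - g \<in> L2 \<Omega>"
  using L2_add[OF assms(1) L2_scaleR[OF assms(2), of "-1"]]
  by (simp add: fun_diff_def)

lemma L2_inner_commute: "L2_inner \<Omega> f g = L2_inner \<Omega> g f"
  by (simp add: L2_inner_def inner_commute)

lemma L2_inner_scaleR_right: "L2_inner \<Omega> f (\<lambda>x. c *\<^sub>R g x) = c * L2_inner \<Omega> f g"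
  by (simp add: L2_inner_def)

lemma L2_inner_diff_right:
  assumes "f \<in> L2 \<Omega>" "g \<in> L2 \<Omega>" "h \<in> L2 \<Omega>"
  shows "L2_inner \<Omega> f (g - h) = L2_inner \<Omega> f g - L2_inner \<Omega> f h"
  using assms by (simp add: L2_inner_def inner_diff_right L2_inner_integrable)

lemma L2_inner_diff_left:
  assumes "f \<in> L2 \<Omega>" "g \<in> L2 \<Omega>" "h \<in> L2 \<Omega>"
  shows "L2_inner \<Omega> (f - g) h = L2_inner \<Omega> f h - L2_inner \<Omega> g h"
  using L2_inner_diff_right[OF assms(3,1,2)] by (simp add: L2_inner_commute)

lemma L2_inner_self_nonneg: "0 \<le> L2_inner \<Omega> f f"
  by (simp add: L2_inner_def)

lemma L2_norm_power2: "(L2_norm \<Omega> f)\<^sup>2 = L2_inner \<Omega> f f"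
  by (simp add: L2_norm_def L2_inner_self_nonneg)

lemma L2_norm_minus_commute: "L2_norm \<Omega> (f - g) = L2_norm \<Omega> (g - f)"
  by (simp add: L2_norm_def L2_inner_def inner_diff algebra_simps)

lemma L2_Cauchy_Schwarz:
  assumes "f \<in> L2 \<Omega>" "g \<in> L2 \<Omega>"
  shows "\<bar>L2_inner \<Omega> f g\<bar> \<le> L2_norm \<Omega> f * L2_norm \<Omega> g"
proof -
  define a p b where "a = L2_inner \<Omega> f f" and "p = L2_inner \<Omega> f g" and "b = L2_inner \<Omega> g g"
  \<comment> \<open>The polynomial \<open>t \<mapsto> \<parallel>f - t g\<parallel>\<^sup>2\<close> is nonnegative.\<close>
  have quad: "0 \<le> a - 2 * t * p + t\<^sup>2 * b" for t
  proof -
    let ?g = "\<lambda>x. t *\<^sub>R g x"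
    have g: "?g \<in> L2 \<Omega>" using assms(2) by (rule L2_scaleR)
    have "0 \<le> L2_inner \<Omega> (f - ?g) (f - ?g)" by (rule L2_inner_self_nonneg)
    also have "\<dots> = a - t * p - (t * p - t * (t * b))"
      using assms g L2_diff[OF assms(1) g]
      by (simp add: a_def p_def b_def L2_inner_diff_left L2_inner_diff_right L2_inner_scaleR_right
          L2_inner_commute[of _ ?g] L2_inner_commute[of _ g f] algebra_simps)
    finally show ?thesis by (simp add: power2_eq_square algebra_simps)
  qed
  have "p\<^sup>2 \<le> a * b"
  proof (cases "b = 0")
    case True
    have "p = 0"
    proof (rule ccontr)
      assume "p \<noteq> 0"
      with quad[of "(a + 1) / (2 * p)"] True show False by simp
    qed
    with True show ?thesis by simp
  next
    case False
    with L2_inner_self_nonneg[of \<Omega> g] have "b > 0" by (simp add: b_def)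
    with quad[of "p / b"] show ?thesis by (simp add: power2_eq_square field_simps)
  qed
  then have "sqrt (p\<^sup>2) \<le> sqrt (a * b)" by (rule real_sqrt_le_mono)
  then show ?thesis by (simp add: a_def p_def b_def L2_norm_def real_sqrt_mult)
qed

text \<open>
  Applied to \<open>a = U - \<sigma>\<close> and \<open>b = U - S\<close>, this is the Prager-Synge identity: the squared distance from \<open>U\<close>
  to the midpoint of \<open>\<sigma>\<close> and \<open>S\<close> is \<open>\<parallel>S - \<sigma>\<parallel>\<^sup>2 / 4\<close> up to a defect of orthogonality.
\<close>

lemma L2_polarization:
  assumes "a \<in> L2 \<Omega>" "b \<in> L2 \<Omega>"
  shows "(L2_norm \<Omega> (\<lambda>x. (1 / 2) *\<^sub>R (a x + b x)))\<^sup>2 = (1 / 2 * L2_norm \<Omega> (a - b))\<^sup>2 + L2_inner \<Omega> a b"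
proof -
  have "(L2_norm \<Omega> (\<lambda>x. (1 / 2) *\<^sub>R (a x + b x)))\<^sup>2 - (1 / 2 * L2_norm \<Omega> (a - b))\<^sup>2
      = (\<integral>x. (1 / 4) * ((a x + b x) \<bullet> (a x + b x)) \<partial>lebesgue_on \<Omega>)
        - (\<integral>x. (1 / 4) * ((a x - b x) \<bullet> (a x - b x)) \<partial>lebesgue_on \<Omega>)"
    by (simp add: power_mult_distrib L2_norm_power2 power_divide L2_inner_def)
  also have "\<dots> = (\<integral>x. (1 / 4) * ((a x + b x) \<bullet> (a x + b x)) - (1 / 4) * ((a x - b x) \<bullet> (a x - b x)) \<partial>lebesgue_on \<Omega>)"
    using L2_inner_integrable[OF L2_add[OF assms] L2_add[OF assms]]
      L2_inner_integrable[OF L2_diff[OF assms] L2_diff[OF assms]]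
    by (subst Bochner_Integration.integral_diff) simp_all
  also have "\<dots> = L2_inner \<Omega> a b"
    unfolding L2_inner_def
    by (intro Bochner_Integration.integral_cong refl)
      (simp add: inner_add inner_diff inner_commute algebra_simps)
  finally show ?thesis by simp
qed

section \<open>Uniqueness and linearity of weak derivatives\<close>

lemma continuous_L2:
  fixes \<phi> :: "'a::euclidean_space \<Rightarrow> 'b::euclidean_space"
  assumes "bounded \<Omega>" "\<Omega> \<in> sets lebesgue" and cont: "continuous_on UNIV \<phi>"
  shows "\<phi> \<in> L2 \<Omega>"
proof -
  have "compact (\<phi> ` closure \<Omega>)"
    using assms(1) by (intro compact_continuous_image continuous_on_subset[OF cont]) auto
  then obtain B where "\<forall>x\<in>closure \<Omega>. norm (\<phi> x) \<le> B"
    by (auto dest!: compact_imp_bounded simp: bounded_iff)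
  then have B: "norm (\<phi> x) \<le> B" if "x \<in> \<Omega>" for x
    using that closure_subset[of \<Omega>] by blast
  have fin: "finite_measure (lebesgue_on \<Omega>)"
    using assms by (intro finite_measure_lebesgue_on bounded_set_imp_lmeasurable)
  have meas: "\<phi> \<in> borel_measurable (lebesgue_on \<Omega>)"
    using borel_measurable_continuous_onI[OF cont]
    by (intro measurable_restrict_space1 measurable_completion) simp
  have "integrable (lebesgue_on \<Omega>) (\<lambda>x. (norm (\<phi> x))\<^sup>2)"
  proof (rule finite_measure.integrable_const_bound[OF fin, where B = "B\<^sup>2"])
    show "AE x in lebesgue_on \<Omega>. norm ((norm (\<phi> x))\<^sup>2) \<le> B\<^sup>2"
      using B by (intro AE_I2) (simp add: power_mono)
  qed (use meas in measurable)
  with meas show ?thesis by (simp add: L2_def)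
qed

lemma partial_derivs_test_function_L2:
  assumes "bounded \<Omega>" "\<Omega> \<in> sets lebesgue" "\<phi> \<in> test_functions \<Omega>'"
  shows "partial_derivs \<alpha> \<phi> \<in> L2 \<Omega>"
  using assms
  by (intro continuous_L2 differentiable_imp_continuous_on) (simp_all add: test_functions_def smooth_def)

lemma test_function_L2:
  assumes "bounded \<Omega>" "\<Omega> \<in> sets lebesgue" "\<phi> \<in> test_functions \<Omega>'"
  shows "\<phi> \<in> L2 \<Omega>"
  using partial_derivs_test_function_L2[OF assms, of "[]"] by simp

lemma L2_integrable_mult:
  fixes f g :: "'a::euclidean_space \<Rightarrow> real"
  shows "f \<in> L2 \<Omega> \<Longrightarrow> g \<in> L2 \<Omega> \<Longrightarrow> integrable (lebesgue_on \<Omega>) (\<lambda>x. f x * g x)"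
  using L2_inner_integrable[of f \<Omega> g] by simp

lemma is_weak_deriv_diff:
  assumes \<Omega>: "bounded \<Omega>" "\<Omega> \<in> sets lebesgue"
    and L2: "v \<in> L2 \<Omega>" "v' \<in> L2 \<Omega>" "w \<in> L2 \<Omega>" "w' \<in> L2 \<Omega>"
    and wd: "is_weak_deriv \<Omega> \<alpha> v w" "is_weak_deriv \<Omega> \<alpha> v' w'"
  shows "is_weak_deriv \<Omega> \<alpha> (v - v') (w - w')"
  unfolding is_weak_deriv_def
proof
  fix \<phi> assume \<phi>: "\<phi> \<in> test_functions \<Omega>"
  note 1 = partial_derivs_test_function_L2[OF \<Omega> \<phi>, of \<alpha>] and 2 = test_function_L2[OF \<Omega> \<phi>]
  show "(\<integral>x. (v - v') x * partial_derivs \<alpha> \<phi> x \<partial>lebesgue_on \<Omega>)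
      = (- 1) ^ length \<alpha> * (\<integral>x. (w - w') x * \<phi> x \<partial>lebesgue_on \<Omega>)"
    using wd \<phi> L2 1 2
    by (simp add: is_weak_deriv_def left_diff_distrib L2_integrable_mult right_diff_distrib)
qed

lemma weak_deriv_unique_AE:
  fixes v :: "real^'n::finite \<Rightarrow> real"
  assumes \<Omega>: "open \<Omega>" "bounded \<Omega>"
    and w: "w \<in> L2 \<Omega>" "w' \<in> L2 \<Omega>" "is_weak_deriv \<Omega> \<alpha> v w" "is_weak_deriv \<Omega> \<alpha> v w'"
  shows "AE x in lebesgue_on \<Omega>. w x = w' x"
proof -
  have meas: "\<Omega> \<in> sets lebesgue" using \<Omega>(1) by simp
  have "(\<lambda>x. 1 :: real) \<in> L2 \<Omega>" using \<Omega> meas by (intro continuous_L2) auto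
  then have int: "integrable (lebesgue_on \<Omega>) (\<lambda>x. w x - w' x)"
    using L2_integrable_mult[OF L2_diff[OF w(1,2)]] by fastforce
  have "AE x in lebesgue_on \<Omega>. w x - w' x = 0"
  proof (rule fundamental_lemma_calculus_of_variations[OF \<Omega>(1) int])
    fix \<phi> assume \<phi>: "\<phi> \<in> test_functions \<Omega>"
    note 1 = test_function_L2[OF \<Omega>(2) meas \<phi>]
    have "(\<integral>x. w x * \<phi> x \<partial>lebesgue_on \<Omega>) = (\<integral>x. w' x * \<phi> x \<partial>lebesgue_on \<Omega>)"
      using w(3,4) \<phi> by (simp add: is_weak_deriv_def)
    then show "(\<integral>x. (w x - w' x) * \<phi> x \<partial>lebesgue_on \<Omega>) = 0"
      using w(1,2) 1 by (simp add: left_diff_distrib L2_integrable_mult)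
  qed
  then show ?thesis by simp
qed

lemma weak_deriv_H2:
  assumes "v \<in> H2 \<Omega>" "length \<alpha> \<le> 2"
  shows "weak_deriv \<Omega> \<alpha> v \<in> L2 \<Omega>" "is_weak_deriv \<Omega> \<alpha> v (weak_deriv \<Omega> \<alpha> v)"
proof -
  have "\<exists>w. w \<in> L2 \<Omega> \<and> is_weak_deriv \<Omega> \<alpha> v w" using assms by (auto simp: H2_def)
  from someI_ex[OF this] show "weak_deriv \<Omega> \<alpha> v \<in> L2 \<Omega>" "is_weak_deriv \<Omega> \<alpha> v (weak_deriv \<Omega> \<alpha> v)"
    by (simp_all add: weak_deriv_def)
qed

lemma H2_diff:
  assumes "bounded \<Omega>" "\<Omega> \<in> sets lebesgue" "v \<in> H2 \<Omega>" "w \<in> H2 \<Omega>"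
  shows "v - w \<in> H2 \<Omega>"
proof -
  have L2: "v \<in> L2 \<Omega>" "w \<in> L2 \<Omega>" using assms by (auto simp: H2_def)
  have "\<exists>z\<in>L2 \<Omega>. is_weak_deriv \<Omega> \<alpha> (v - w) z" if \<alpha>: "length \<alpha> \<le> 2" for \<alpha>
  proof
    note v = weak_deriv_H2[OF assms(3) \<alpha>] and w = weak_deriv_H2[OF assms(4) \<alpha>]
    show "weak_deriv \<Omega> \<alpha> v - weak_deriv \<Omega> \<alpha> w \<in> L2 \<Omega>"
      by (rule L2_diff[OF v(1) w(1)])
    show "is_weak_deriv \<Omega> \<alpha> (v - w) (weak_deriv \<Omega> \<alpha> v - weak_deriv \<Omega> \<alpha> w)"
      by (rule is_weak_deriv_diff[OF assms(1,2) L2 v(1) w(1) v(2) w(2)])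
  qed
  then show ?thesis using L2_diff[OF L2] by (simp add: H2_def)
qed

lemma hessian_L2:
  fixes v :: "real^'n::finite \<Rightarrow> real"
  assumes "v \<in> H2 \<Omega>"
  shows "hessian \<Omega> v \<in> L2 \<Omega>"
proof -
  have L2: "weak_deriv \<Omega> [i, j] v \<in> L2 \<Omega>" for i j
    using assms by (intro weak_deriv_H2) auto
  have "hessian \<Omega> v \<in> borel_measurable (lebesgue_on \<Omega>)"
    using L2 unfolding borel_measurable_euclidean_space[of "hessian \<Omega> v"]
    by (auto simp: Basis_vec_def inner_axis hessian_def L2_def)
  moreover have "(norm A)\<^sup>2 = (\<Sum>i\<in>UNIV. \<Sum>j\<in>UNIV. (norm (A $ i $ j))\<^sup>2)" for A :: "real^'n^'n"
    unfolding power2_norm_eq_inner inner_vec_def by (rule refl)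
  ultimately show ?thesis using L2 by (simp add: L2_def hessian_def)
qed

lemma hessian_diff_AE:
  assumes \<Omega>: "open \<Omega>" "bounded \<Omega>" and H2: "v \<in> H2 \<Omega>" "w \<in> H2 \<Omega>"
  shows "AE x in lebesgue_on \<Omega>. hessian \<Omega> (v - w) x = hessian \<Omega> v x - hessian \<Omega> w x"
proof -
  have meas: "\<Omega> \<in> sets lebesgue" using \<Omega>(1) by simp
  have "AE x in lebesgue_on \<Omega>.
      weak_deriv \<Omega> [i, j] (v - w) x = weak_deriv \<Omega> [i, j] v x - weak_deriv \<Omega> [i, j] w x" for i j
  proof -
    note v = weak_deriv_H2[OF H2(1), of "[i, j]"] and w = weak_deriv_H2[OF H2(2), of "[i, j]"]
      and vw = weak_deriv_H2[OF H2_diff[OF \<Omega>(2) meas H2], of "[i, j]"]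
    have "v \<in> L2 \<Omega>" "w \<in> L2 \<Omega>" using H2 by (auto simp: H2_def)
    then have "is_weak_deriv \<Omega> [i, j] (v - w) (weak_deriv \<Omega> [i, j] v - weak_deriv \<Omega> [i, j] w)"
      using v w by (intro is_weak_deriv_diff \<Omega> meas) auto
    from weak_deriv_unique_AE[OF \<Omega> vw(1) L2_diff[OF v(1) w(1)] vw(2) this]
    show ?thesis by simp
  qed
  then have "AE x in lebesgue_on \<Omega>. \<forall>i j.
      weak_deriv \<Omega> [i, j] (v - w) x = weak_deriv \<Omega> [i, j] v x - weak_deriv \<Omega> [i, j] w x"
    by (simp add: AE_all_countable)
  then show ?thesis by eventually_elim (simp add: hessian_def vec_eq_iff)
qed

lemma div_div_diff:
  assumes \<Omega>: "open \<Omega>" "bounded \<Omega>" and \<tau>: "\<tau> \<in> L2 \<Omega>" and H2: "v \<in> H2 \<Omega>" "w \<in> H2 \<Omega>"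
  shows "div_div \<Omega> \<tau> (v - w) = div_div \<Omega> \<tau> v - div_div \<Omega> \<tau> w"
proof -
  have meas: "\<Omega> \<in> sets lebesgue" using \<Omega>(1) by simp
  have "L2_inner \<Omega> \<tau> (hessian \<Omega> (v - w)) = L2_inner \<Omega> \<tau> (hessian \<Omega> v - hessian \<Omega> w)"
    unfolding L2_inner_def
  proof (rule integral_cong_AE)
    show "AE x in lebesgue_on \<Omega>. \<tau> x \<bullet> hessian \<Omega> (v - w) x = \<tau> x \<bullet> (hessian \<Omega> v - hessian \<Omega> w) x"
      using hessian_diff_AE[OF \<Omega> H2] by eventually_elim simp
  qed (intro borel_measurable_integrable L2_inner_integrable L2_diff hessian_L2 \<tau> H2
      H2_diff[OF \<Omega>(2) meas H2])+
  then show ?thesis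
    using L2_inner_diff_right[OF \<tau> hessian_L2[OF H2(1)] hessian_L2[OF H2(2)]] by (simp add: div_div_def)
qed

section \<open>Goal-oriented error estimate\<close>

theorem theorem4p4:
  fixes \<Omega> :: "(real^2) set" and \<T> :: "(real^2) set set" and \<kappa> :: real and k :: nat
    and f :: "(real^2 \<Rightarrow> real) \<Rightarrow> real" and f' :: "real^2 \<Rightarrow> real"
    and u u' u\<^sub>h u'\<^sub>h s\<^sub>h s'\<^sub>h :: "real^2 \<Rightarrow> real"
    and \<sigma>\<^sub>h \<sigma>'\<^sub>h \<sigma>m :: "real^2 \<Rightarrow> real^2^2"
    and f\<^sub>h f'\<^sub>h Q :: "(real^2 \<Rightarrow> real) \<Rightarrow> real"
    and osc_prim osc_dual :: real
  assumes domain: "bounded \<Omega>" "polygonal \<Omega>" "lipschitz_domain \<Omega>"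
    and mesh: "triangulation_of \<Omega> \<T>" "shape_regular \<kappa> \<T>"
    and f: "f \<in> H_minus2 \<Omega>"
    and f': "f' \<in> L2 \<Omega>"
    and u: "biharmonic_solution \<Omega> f u"
    and u': "biharmonic_solution \<Omega> (L2_inner \<Omega> f') u'"
    and Q: "Q = L2_inner \<Omega> f'"
    and u\<^sub>h: "u\<^sub>h \<in> piecewise_polynomials k \<Omega> \<T>"
    and u'\<^sub>h: "u'\<^sub>h \<in> piecewise_polynomials k \<Omega> \<T>"
    and s\<^sub>h: "s\<^sub>h \<in> potential_reconstructions \<Omega>"
    and s'\<^sub>h: "s'\<^sub>h \<in> potential_reconstructions \<Omega>"
    and \<sigma>\<^sub>h: "\<sigma>\<^sub>h \<in> L2_sym \<Omega>" "f\<^sub>h = div_div \<Omega> \<sigma>\<^sub>h"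
    and \<sigma>'\<^sub>h: "\<sigma>'\<^sub>h \<in> L2_sym \<Omega>" "f'\<^sub>h = div_div \<Omega> \<sigma>'\<^sub>h"
    and \<sigma>m: "\<sigma>m = (\<lambda>x. (1 / 2) *\<^sub>R (\<sigma>'\<^sub>h x + hessian \<Omega> s'\<^sub>h x))"
    and osc_prim: "osc_prim = osc f f\<^sub>h u' s'\<^sub>h"
    and osc_dual: "osc_dual = osc (L2_inner \<Omega> f') f'\<^sub>h u' s'\<^sub>h"
  shows "\<bar>Q u - Q u\<^sub>h - L2_inner \<Omega> (\<sigma>\<^sub>h - hessian \<Omega> s\<^sub>h) \<sigma>m\<bar>
    \<le> L2_norm \<Omega> (hessian \<Omega> s\<^sub>h - \<sigma>\<^sub>h)
          * (1 / 2 * L2_norm \<Omega> (hessian \<Omega> s'\<^sub>h - \<sigma>'\<^sub>h) + osc_dual)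
        + \<bar>(f - f\<^sub>h) s'\<^sub>h + Q (s\<^sub>h - u\<^sub>h)\<bar>
        + osc_prim\<^sup>2"
proof -
  have op: "open \<Omega>" using domain(3) by (simp add: lipschitz_domain_def)
  have H20: "u \<in> H2_0 \<Omega>" "u' \<in> H2_0 \<Omega>" "s\<^sub>h \<in> H2_0 \<Omega>" "s'\<^sub>h \<in> H2_0 \<Omega>"
    using u u' s\<^sub>h s'\<^sub>h by (auto simp: biharmonic_solution_def potential_reconstructions_def)
  then have H2: "u \<in> H2 \<Omega>" "u' \<in> H2 \<Omega>" "s\<^sub>h \<in> H2 \<Omega>" "s'\<^sub>h \<in> H2 \<Omega>"
    by (auto simp: H2_0_def)
  then have L2: "u \<in> L2 \<Omega>" "u' \<in> L2 \<Omega>" "s\<^sub>h \<in> L2 \<Omega>" "s'\<^sub>h \<in> L2 \<Omega>" "u\<^sub>h \<in> L2 \<Omega>"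
    using u\<^sub>h by (auto simp: H2_def piecewise_polynomials_def)
  define U U' S S' where "U = hessian \<Omega> u" and "U' = hessian \<Omega> u'"
    and "S = hessian \<Omega> s\<^sub>h" and "S' = hessian \<Omega> s'\<^sub>h"
  note defs = U_def U'_def S_def S'_def
  have hL2: "U \<in> L2 \<Omega>" "U' \<in> L2 \<Omega>" "S \<in> L2 \<Omega>" "S' \<in> L2 \<Omega>" "\<sigma>\<^sub>h \<in> L2 \<Omega>" "\<sigma>'\<^sub>h \<in> L2 \<Omega>"
    using H2 \<sigma>\<^sub>h \<sigma>'\<^sub>h by (auto simp: defs L2_sym_def intro: hessian_L2)
  have prim: "L2_inner \<Omega> U (hessian \<Omega> v) = f v" and dual: "L2_inner \<Omega> U' (hessian \<Omega> v) = L2_inner \<Omega> f' v"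
    if "v \<in> H2_0 \<Omega>" for v
    using u u' that by (auto simp: biharmonic_solution_def defs)
  have f_diff: "f (u' - s'\<^sub>h) = f u' - f s'\<^sub>h"
  proof -
    have "f (\<lambda>x. 1 * u' x + (- 1) * s'\<^sub>h x) = 1 * f u' + (- 1) * f s'\<^sub>h"
      using f H20 unfolding H_minus2_def by blast
    then show ?thesis by (simp add: fun_diff_def)
  qed
  define \<delta> where "\<delta> = (L2_inner \<Omega> f' - f'\<^sub>h) (u' - s'\<^sub>h)"
  define \<rho> where "\<rho> = (f - f\<^sub>h) (u' - s'\<^sub>h)"
  have osc_prim2: "osc_prim\<^sup>2 = \<bar>\<rho>\<bar>" and osc_dual2: "osc_dual\<^sup>2 = \<bar>\<delta>\<bar>" and osc_dual_nonneg: "0 \<le> osc_dual"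
    by (simp_all add: osc_prim osc_dual osc_def \<rho>_def \<delta>_def)

  have \<rho>: "\<rho> = f u' - f s'\<^sub>h - (L2_inner \<Omega> \<sigma>\<^sub>h U' - L2_inner \<Omega> \<sigma>\<^sub>h S')"
    using div_div_diff[OF op domain(1) hL2(5) H2(2,4)] f_diff
    by (simp add: \<rho>_def \<sigma>\<^sub>h(2) div_div_def defs)
  have \<delta>: "\<delta> = L2_inner \<Omega> (U' - \<sigma>'\<^sub>h) (U' - S')"
  proof -
    have "\<delta> = L2_inner \<Omega> f' u' - L2_inner \<Omega> f' s'\<^sub>h - (L2_inner \<Omega> \<sigma>'\<^sub>h U' - L2_inner \<Omega> \<sigma>'\<^sub>h S')"
      using div_div_diff[OF op domain(1) hL2(6) H2(2,4)] L2_inner_diff_right[OF f' L2(2,4)]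
      by (simp add: \<delta>_def \<sigma>'\<^sub>h(2) div_div_def defs)
    also have "L2_inner \<Omega> f' u' = L2_inner \<Omega> U' U'" using dual[OF H20(2)] by (simp add: defs)
    also have "L2_inner \<Omega> f' s'\<^sub>h = L2_inner \<Omega> U' S'" using dual[OF H20(4)] by (simp add: defs)
    finally show ?thesis
      using hL2 by (simp add: L2_inner_diff_left L2_inner_diff_right L2_diff)
  qed

  have "Q u - Q u\<^sub>h - L2_inner \<Omega> (\<sigma>\<^sub>h - S) \<sigma>m
      = L2_inner \<Omega> (\<sigma>\<^sub>h - S) (U' - \<sigma>m) + ((f - f\<^sub>h) s'\<^sub>h + Q (s\<^sub>h - u\<^sub>h)) + \<rho>"
  proof -
    have m: "\<sigma>m \<in> L2 \<Omega>" using hL2 by (auto simp: \<sigma>m defs intro!: L2_scaleR L2_add)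
    have "Q u = f u'"
      using prim[OF H20(2)] dual[OF H20(1)] by (simp add: Q defs L2_inner_commute)
    moreover have "Q s\<^sub>h = L2_inner \<Omega> S U'"
      using dual[OF H20(3)] by (simp add: Q defs L2_inner_commute)
    moreover have "Q (s\<^sub>h - u\<^sub>h) = Q s\<^sub>h - Q u\<^sub>h"
      using L2_inner_diff_right[OF f' L2(3,5)] by (simp add: Q)
    moreover have "f\<^sub>h s'\<^sub>h = L2_inner \<Omega> \<sigma>\<^sub>h S'" by (simp add: \<sigma>\<^sub>h(2) div_div_def defs)
    moreover have "L2_inner \<Omega> (\<sigma>\<^sub>h - S) (U' - \<sigma>m)
        = L2_inner \<Omega> \<sigma>\<^sub>h U' - L2_inner \<Omega> S U' - L2_inner \<Omega> (\<sigma>\<^sub>h - S) \<sigma>m"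
      using hL2 m by (simp add: L2_inner_diff_left L2_inner_diff_right L2_diff)
    ultimately show ?thesis by (simp add: \<rho>)
  qed
  moreover have "\<bar>L2_inner \<Omega> (\<sigma>\<^sub>h - S) (U' - \<sigma>m)\<bar>
      \<le> L2_norm \<Omega> (S - \<sigma>\<^sub>h) * (1 / 2 * L2_norm \<Omega> (S' - \<sigma>'\<^sub>h) + osc_dual)"
  proof -
    have m: "U' - \<sigma>m = (\<lambda>x. (1 / 2) *\<^sub>R ((U' - \<sigma>'\<^sub>h) x + (U' - S') x))"
    proof
      fix x
      have "U' x = (1 / 2) *\<^sub>R (U' x + U' x)" by (simp add: scaleR_2[symmetric])
      then show "(U' - \<sigma>m) x = (1 / 2) *\<^sub>R ((U' - \<sigma>'\<^sub>h) x + (U' - S') x)"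
        by (simp add: \<sigma>m defs algebra_simps)
    qed
    have L2s: "U' - \<sigma>'\<^sub>h \<in> L2 \<Omega>" "U' - S' \<in> L2 \<Omega>" using hL2 by (simp_all add: L2_diff)
    have mL2: "U' - \<sigma>m \<in> L2 \<Omega>" unfolding m by (intro L2_scaleR L2_add L2s)
    define \<eta> where "\<eta> = 1 / 2 * L2_norm \<Omega> (S' - \<sigma>'\<^sub>h)"
    have \<eta>: "0 \<le> \<eta>" by (simp add: \<eta>_def L2_norm_def L2_inner_self_nonneg)
    have "(L2_norm \<Omega> (U' - \<sigma>m))\<^sup>2 = \<eta>\<^sup>2 + \<delta>"
    proof -
      have "(U' - \<sigma>'\<^sub>h) - (U' - S') = S' - \<sigma>'\<^sub>h" by (simp add: fun_eq_iff)
      then show ?thesis unfolding m L2_polarization[OF L2s] by (simp add: \<eta>_def \<delta>)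
    qed
    also have "\<dots> \<le> \<eta>\<^sup>2 + osc_dual\<^sup>2 + 2 * \<eta> * osc_dual"
      using osc_dual2 osc_dual_nonneg \<eta> abs_ge_self[of \<delta>] mult_nonneg_nonneg[of \<eta> osc_dual] by linarith
    also have "\<dots> = (\<eta> + osc_dual)\<^sup>2" by (simp add: power2_sum)
    finally have "L2_norm \<Omega> (U' - \<sigma>m) \<le> \<eta> + osc_dual"
      by (rule power2_le_imp_le) (use \<eta> osc_dual_nonneg in simp)
    then have "L2_norm \<Omega> (\<sigma>\<^sub>h - S) * L2_norm \<Omega> (U' - \<sigma>m) \<le> L2_norm \<Omega> (\<sigma>\<^sub>h - S) * (\<eta> + osc_dual)"
      by (intro mult_left_mono) (simp_all add: L2_norm_def L2_inner_self_nonneg)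
    with L2_Cauchy_Schwarz[OF L2_diff[OF hL2(5,3)] mL2] show ?thesis
      by (simp add: \<eta>_def L2_norm_minus_commute[of \<Omega> S \<sigma>\<^sub>h])
  qed
  ultimately show ?thesis
    unfolding osc_prim2 defs by linarith
qed
end
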